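(* Consider a run of Algorithm BCD (described in the context) applied to the minimization of $f(\boldsymbol{x}_1,\dots,\boldsymbol{x}_{n_{\mathrm{blocks}}})$ subject to $\boldsymbol{x}_i\in\Omega_i$, $i=1,\dots,n_{\mathrm{blocks}}$. Assume that the Lipschitz assumption, the bounded-Hessian assumption, the lower-boundedness assumption and the block-choice assumption stated in the context hold (with constants $\gamma$, $c_B$, $m$), and that for all $k\in\mathbb{N}$ the computation of $j_k$ and $\boldsymbol{x}_{i_k}^{\mathrm{trial}}$ at Step 2 is possible. For $i\in\{1,\dots,n_{\mathrm{blocks}}\}$ and $k\ge m$, define $o(i,k):=j_{\hat k}$, where $\hat k$ is the latest iteration (not larger than $k$) at which $i_{\hat k}=i$, and let $\mu_{i,o(i,k),\ell}$, $\ell=1,\dots,n_{\mathrm g}(i,o(i,k))$, be the multipliers associated in Step 2 of iteration $\hat k$ with the accepted trial point $\boldsymbol{x}_i^{\hat k+1}$. Then, given $\varepsilon>0$, the algorithm performs at most \[ n_{\mathrm{blocks}}\left(\frac{f(x^0)-f_{\mathrm{bound}}}{\alpha(\varepsilon/(c_4m))^2}\right) \] iterations and at most \[ \log_2\left(\frac{\gamma+c_B+2\alpha}{\sigma_{\min}}\right)+2 \] functional evaluations per iteration, where $f_{\mathrm{bound}}$ is an arbitrary lower bound of $\{f(x^k)\}$, $c_4:=c_B+\sigma_{\max}+\theta+\gamma$ and $\sigma_{\max}:=2(\gamma+c_B+2\alpha)$, to compute an iterate $x^{k+1}$ such that \[ \boldsymbol{x}_i^{k+1}\in A_{i,o(i,k)},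 \] \[ \mu_{i,o(i,k),\ell}\ge0\quad\text{and}\quad\min\{\mu_{i,o(i,k),\ell},\,-g_{i,o(i,k),\ell}(\boldsymbol{x}_i^{k+1})\}\le\delta,\quad \ell=1,\dots,n_{\mathrm g}(i,o(i,k)), \] and \[ \left\|\nabla_if(x^{k+1})+\sum_{\ell=1}^{n_{\mathrm g}(i,o(i,k))}\mu_{i,o(i,k),\ell}\nabla g_{i,o(i,k),\ell}(\boldsymbol{x}_i^{k+1})\right\|\le\varepsilon \] for all $i=1,\dots,n_{\mathrm{blocks}}$.
   Context: Notation. $\|\cdot\|$ is the Euclidean norm (and the induced matrix norm), $\mathbb{N}=\{0,1,2,\dots\}$. $f:\mathbb{R}^n\to\mathbb{R}$ is smooth, $n=\sum_{i=1}^{n_{\mathrm{blocks}}}n_i$ with $n_i\ge1$, and $x\in\mathbb{R}^n$ is written in blocks $x=(\boldsymbol{x}_1,\dots,\boldsymbol{x}_{n_{\mathrm{blocks}}})$, $\boldsymbol{x}_i\in\mathbb{R}^{n_i}$; $\nabla_i$ is the gradient with respect to the $i$th block. We write $f(x)=f(\boldsymbol{x}_1,\dots,\boldsymbol{x}_{n_{\mathrm{blocks}}})$. Feasible sets. For each $i=1,\dots,n_{\mathrm{blocks}}$, $\Omega_i\subset\mathbb{R}^{n_i}$ is closed and bounded, and there are open sets $A_{i,j}$, $j=1,\dots,n_{\mathrm{ops}}(i)$, with $\Omega_i\subset\bigcup_{j}A_{i,j}$, and smooth functions $g_{i,j,\ell}:A_{i,j}\to\mathbb{R}$, $\ell=1,\dots,n_{\mathrm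 g}(i,j)$, such that $\Omega_i\cap A_{i,j}=\{\boldsymbol{x}_i\in A_{i,j}: g_{i,j,\ell}(\boldsymbol{x}_i)\le0,\ \ell=1,\dots,n_{\mathrm g}(i,j)\}$. Algorithm BCD. Given $\alpha>0$, $\delta\ge0$, $\theta>0$, $\sigma_{\min}>0$ and $\boldsymbol{x}_i^0\in\Omega_i$ for all $i$; set $k\leftarrow0$. Step 1. Set $\sigma\leftarrow0$, choose $i_k\in\{1,\dots,n_{\mathrm{blocks}}\}$ and a symmetric matrix $B_k\in\mathbb{R}^{n_{i_k}\times n_{i_k}}$. Step 2. Find $j_k\in\{1,\dots,n_{\mathrm{ops}}(i_k)\}$ and $\boldsymbol{x}_{i_k}^{\mathrm{trial}}\in A_{i_k,j_k}$ such that, if $\sigma>0$, Alternative 1 holds, and, if $\sigma=0$, Alternative 1 or Alternative 2 holds. Put $s=\boldsymbol{x}_{i_k}^{\mathrm{trial}}-\boldsymbol{x}_{i_k}^k$. Alternative 1: $\nabla_{i_k}f(x^k)^Ts+\frac12 s^TB_ks+\frac{\sigma}{2}\|s\|^2\le0$ and there exist $\mu_{i_k,j_k,\ell}\ge0$, $\ell=1,\dots,n_{\mathrm g}(i_k,j_k)$, with $\left\|\nabla_{i_k}f(x^k)+B_ks+\sigma s+\sum_{\ell}\mu_{i_k,j_k,\ell}\nabla g_{i_k,j_k,\ell}(\boldsymbol{x}_{i_k}^{\mathrm{trial}})\right\|\le\theta\|s\|$ and $\min\{\mu_{i_k,j_k,\ell},-g_{i_k,j_k,\ell}(\boldsymbol{x}_{i_k}^{\mathrm{trial}})\}\le\delta$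 for all $\ell$. Alternative 2: there exist $\mu_{i_k,j_k,\ell}\ge0$, $\ell=1,\dots,n_{\mathrm g}(i_k,j_k)$, with $\left\|\nabla_{i_k}f(\boldsymbol{x}_1^k,\dots,\boldsymbol{x}_{i_k}^{\mathrm{trial}},\dots,\boldsymbol{x}_{n_{\mathrm{blocks}}}^k)+\sum_\ell\mu_{i_k,j_k,\ell}\nabla g_{i_k,j_k,\ell}(\boldsymbol{x}_{i_k}^{\mathrm{trial}})\right\|=0$ and $\min\{\mu_{i_k,j_k,\ell},-g_{i_k,j_k,\ell}(\boldsymbol{x}_{i_k}^{\mathrm{trial}})\}\le0$ for all $\ell$. Step 3. Test the sufficient descent condition $f(\boldsymbol{x}_1^k,\dots,\boldsymbol{x}_{i_k}^{\mathrm{trial}},\dots,\boldsymbol{x}_{n_{\mathrm{blocks}}}^k)\le f(x^k)-\alpha\|\boldsymbol{x}_{i_k}^{\mathrm{trial}}-\boldsymbol{x}_{i_k}^k\|^2$. If it holds, define $\sigma_k=\sigma$, $\boldsymbol{x}_{i_k}^{k+1}=\boldsymbol{x}_{i_k}^{\mathrm{trial}}$, $\boldsymbol{x}_i^{k+1}=\boldsymbol{x}_i^k$ for $i\ne i_k$, set $k\leftarrow k+1$ and go to Step 1. Otherwise set $\sigma\leftarrow\max\{\sigma_{\min},2\sigma\}$ and go to Step 2 (so $j_k$, the trial point and the multipliers are recomputed; after acceptance, $j_k$ and the multipliers of iteration $k$ denote those of the accepted trial point). The number of functional evaluations of an iteration is the number of increases of $\sigma$ at Step 3 plus one. Lipschitz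 assumption. There is $\gamma>0$ such that for all $\boldsymbol{x}_{i_k}^k$ and $\boldsymbol{x}_{i_k}^{\mathrm{trial}}$ computed by the algorithm, $\|\nabla_{i_k}f(x^k)-\nabla_{i_k}f(\boldsymbol{x}_1^k,\dots,\boldsymbol{x}_{i_k}^{\mathrm{trial}},\dots,\boldsymbol{x}_{n_{\mathrm{blocks}}}^k)\|\le\gamma\|\boldsymbol{x}_{i_k}^k-\boldsymbol{x}_{i_k}^{\mathrm{trial}}\|$ and $f(\boldsymbol{x}_1^k,\dots,\boldsymbol{x}_{i_k}^{\mathrm{trial}},\dots,\boldsymbol{x}_{n_{\mathrm{blocks}}}^k)\le f(x^k)+\nabla_{i_k}f(x^k)^T(\boldsymbol{x}_{i_k}^{\mathrm{trial}}-\boldsymbol{x}_{i_k}^k)+\frac{\gamma}{2}\|\boldsymbol{x}_{i_k}^k-\boldsymbol{x}_{i_k}^{\mathrm{trial}}\|^2$; moreover, if $x^{k_1}$ differs from $x^{k_2}$ in only one block $i_{\mathrm{diff}}$, then $\|\nabla_if(x^{k_1})-\nabla_if(x^{k_2})\|\le\gamma\|\boldsymbol{x}_{i_{\mathrm{diff}}}^{k_2}-\boldsymbol{x}_{i_{\mathrm{diff}}}^{k_1}\|$ for all $i=1,\dots,n_{\mathrm{blocks}}$. Bounded-Hessian assumption. There is $c_B>0$ such that $\|B_k\|\le c_B$ for all $k\in\mathbb{N}$. Lower-boundedness assumption. The sequence $\{f(x^k)\}$ is bounded below. Block-choice assumption. There is $m\in\{1,2,\dots\}$ such that, for all $\nu\in\{1,\dots,n_{\mathrm{blocks}}\}$,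 $i_k=\nu$ infinitely many times and, if $k_1<k_2<k_3<\dots$ are all the iteration indices $k$ with $i_k=\nu$, then $k_1\le m$ and $k_{j+1}-k_j\le m$ for all $j=1,2,3,\dots$.
   Formalization: The iteration bound counts only iterations k≥m that fail the criterion (so a good k is at most m plus the stated bound); the evaluation bound is rounded up to an integer; and σ_min<σ_max is assumed. The literal claims are false without these changes. *)

theory Defs
  imports "HOL-Analysis.Analysis"
begin

text \<open>
  The block structure of \<open>real ^ 'n\<close> is a map \<open>blk\<close> that assigns to each coordinate the number
  of its block. The space of the \<open>i\<close>-th block, of dimension \<open>card {c. blk c = i}\<close>, is represented
  by the coordinate subspace of the vectors that vanish outside block \<open>i\<close>; this identification
  preserves inner products and norms. Accordingly, "open" and "derivative" for objects
  living on the \<open>i\<close>-th block are taken relative to this subspace.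
\<close>

definition block_space :: "('n::finite \<Rightarrow> nat) \<Rightarrow> nat \<Rightarrow> (real ^ 'n) set" where
  "block_space blk i = {v. \<forall>c. blk c \<noteq> i \<longrightarrow> v $ c = 0}"

definition block :: "('n::finite \<Rightarrow> nat) \<Rightarrow> nat \<Rightarrow> real ^ 'n \<Rightarrow> real ^ 'n" where
  "block blk i x = (\<chi> c. if blk c = i then x $ c else 0)"

definition replace_block ::
    "('n::finite \<Rightarrow> nat) \<Rightarrow> nat \<Rightarrow> real ^ 'n \<Rightarrow> real ^ 'n \<Rightarrow> real ^ 'n" where
  "replace_block blk i y x = (\<chi> c. if blk c = i then y $ c else x $ c)"

definition has_block_grad ::
    "('n::finite \<Rightarrow> nat) \<Rightarrow> nat \<Rightarrow> (real ^ 'n \<Rightarrow> real) \<Rightarrow> real ^ 'n \<Rightarrow> real ^ 'n \<Rightarrow> bool" where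
  "has_block_grad blk i h y d \<longleftrightarrow>
     d \<in> block_space blk i \<and> (h has_derivative (\<lambda>s. d \<bullet> s)) (at y within block_space blk i)"

definition block_grad ::
    "('n::finite \<Rightarrow> nat) \<Rightarrow> nat \<Rightarrow> (real ^ 'n \<Rightarrow> real) \<Rightarrow> real ^ 'n \<Rightarrow> real ^ 'n" where
  "block_grad blk i h y = (THE d. has_block_grad blk i h y d)"

definition partial_grad ::
    "('n::finite \<Rightarrow> nat) \<Rightarrow> (real ^ 'n \<Rightarrow> real) \<Rightarrow> nat \<Rightarrow> real ^ 'n \<Rightarrow> real ^ 'n" where
  "partial_grad blk f i x = block_grad blk i (\<lambda>y. f (replace_block blk i y x)) (block blk i x)"

text \<open>Smooth means continuously differentiable.\<close>

definition smooth_fun :: "(real ^ 'n::finite \<Rightarrow> real) \<Rightarrow> bool" where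
  "smooth_fun f \<longleftrightarrow> (\<exists>G. (\<forall>x. GDERIV f x :> G x) \<and> continuous_on UNIV G)"

definition block_smooth_on ::
    "('n::finite \<Rightarrow> nat) \<Rightarrow> nat \<Rightarrow> (real ^ 'n) set \<Rightarrow> (real ^ 'n \<Rightarrow> real) \<Rightarrow> bool" where
  "block_smooth_on blk i A h \<longleftrightarrow>
     (\<exists>G. (\<forall>y\<in>A. has_block_grad blk i h y (G y)) \<and> continuous_on A G)"

text \<open>
  A matrix acting on the \<open>i\<close>-th block is extended by zero to all coordinates, which
  preserves its operator norm.
\<close>

definition block_symmetric :: "('n::finite \<Rightarrow> nat) \<Rightarrow> nat \<Rightarrow> real ^ 'n ^ 'n \<Rightarrow> bool" where
  "block_symmetric blk i B \<longleftrightarrow>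
     transpose B = B \<and> (\<forall>r c. blk r \<noteq> i \<or> blk c \<noteq> i \<longrightarrow> B $ r $ c = 0)"

locale bcd_problem =
  fixes f :: "real ^ 'n::finite \<Rightarrow> real"
    and nblocks :: nat
    and blk :: "'n \<Rightarrow> nat"
    and \<Omega> :: "nat \<Rightarrow> (real ^ 'n) set"
    and nops :: "nat \<Rightarrow> nat"
    and A :: "nat \<Rightarrow> nat \<Rightarrow> (real ^ 'n) set"
    and ng :: "nat \<Rightarrow> nat \<Rightarrow> nat"
    and g :: "nat \<Rightarrow> nat \<Rightarrow> nat \<Rightarrow> real ^ 'n \<Rightarrow> real"
  assumes f_smooth: "smooth_fun f"
    and blocks: "range blk = {1..nblocks}"
    and Omega_space: "i \<in> {1..nblocks} \<Longrightarrow> \<Omega> i \<subseteq> block_space blk i"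
    and Omega_closed: "i \<in> {1..nblocks} \<Longrightarrow> closed (\<Omega> i)"
    and Omega_bounded: "i \<in> {1..nblocks} \<Longrightarrow> bounded (\<Omega> i)"
    and A_open: "\<lbrakk>i \<in> {1..nblocks}; j \<in> {1..nops i}\<rbrakk>
        \<Longrightarrow> openin (top_of_set (block_space blk i)) (A i j)"
    and Omega_cover: "i \<in> {1..nblocks} \<Longrightarrow> \<Omega> i \<subseteq> (\<Union>j\<in>{1..nops i}. A i j)"
    and g_smooth: "\<lbrakk>i \<in> {1..nblocks}; j \<in> {1..nops i}; l \<in> {1..ng i j}\<rbrakk>
        \<Longrightarrow> block_smooth_on blk i (A i j) (g i j l)"
    and Omega_local: "\<lbrakk>i \<in> {1..nblocks}; j \<in> {1..nops i}\<rbrakk>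
        \<Longrightarrow> \<Omega> i \<inter> A i j = {y \<in> A i j. \<forall>l\<in>{1..ng i j}. g i j l y \<le> 0}"

text \<open>The value of \<open>\<sigma>\<close> after \<open>t\<close> increases within one iteration.\<close>

primrec sigma_seq :: "real \<Rightarrow> nat \<Rightarrow> real" where
  "sigma_seq \<sigma>min 0 = 0"
| "sigma_seq \<sigma>min (Suc t) = max \<sigma>min (2 * sigma_seq \<sigma>min t)"

text \<open>
  The requirements on a trial point \<open>y\<close> for block \<open>i\<close> at the iterate \<open>x\<close>; \<open>j\<close> is the index of the
  open set containing \<open>y\<close> and \<open>\<mu>\<close> are the multipliers.
\<close>

definition alternative1 where
  "alternative1 f blk ng g \<delta> \<theta> x i B \<sigma> j y \<mu> \<longleftrightarrow>
     (let s = y - block blk i x in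
        partial_grad blk f i x \<bullet> s + 1 / 2 * (s \<bullet> (B *v s)) + \<sigma> / 2 * (norm s)\<^sup>2 \<le> 0 \<and>
        (\<forall>l\<in>{1..ng i j}. \<mu> l \<ge> 0) \<and>
        norm (partial_grad blk f i x + B *v s + \<sigma> *\<^sub>R s
              + (\<Sum>l\<in>{1..ng i j}. \<mu> l *\<^sub>R block_grad blk i (g i j l) y)) \<le> \<theta> * norm s \<and>
        (\<forall>l\<in>{1..ng i j}. min (\<mu> l) (- g i j l y) \<le> \<delta>))"

definition alternative2 where
  "alternative2 f blk ng g x i j y \<mu> \<longleftrightarrow>
     (\<forall>l\<in>{1..ng i j}. \<mu> l \<ge> (0::real)) \<and>
     norm (partial_grad blk f i (replace_block blk i y x)
           + (\<Sum>l\<in>{1..ng i j}. \<mu> l *\<^sub>R block_grad blk i (g i j l) y)) = 0 \<and>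
     (\<forall>l\<in>{1..ng i j}. min (\<mu> l) (- g i j l y) \<le> 0)"

definition step2 where
  "step2 f blk nops A ng g \<delta> \<theta> x i B \<sigma> j y \<mu> \<longleftrightarrow>
     j \<in> {1..nops i} \<and> y \<in> A i j \<and>
     (alternative1 f blk ng g \<delta> \<theta> x i B \<sigma> j y \<mu> \<or>
      \<sigma> = 0 \<and> alternative2 f blk ng g x i j y \<mu>)"

definition sufficient_descent ::
    "(real ^ 'n::finite \<Rightarrow> real) \<Rightarrow> ('n \<Rightarrow> nat) \<Rightarrow> real \<Rightarrow> real ^ 'n \<Rightarrow> nat \<Rightarrow> real ^ 'n \<Rightarrow> bool" where
  "sufficient_descent f blk \<alpha> x i y \<longleftrightarrow>
     f (replace_block blk i y x) \<le> f x - \<alpha> * (norm (y - block blk i x))\<^sup>2"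

text \<open>
  In a run, \<open>x k\<close>, \<open>ik k\<close> and \<open>B k\<close> are the iterate, the chosen block and the chosen matrix of
  iteration \<open>k\<close>; \<open>j k t\<close>, \<open>y k t\<close> and \<open>\<mu> k t\<close> are the data of the trial point computed at
  iteration \<open>k\<close> after \<open>t\<close> increases of \<open>\<sigma>\<close>. The inner loop of an iteration is not presupposed to end. The pair \<open>(k, t)\<close> is
  reached if all iterations before \<open>k\<close> ended and the trial points \<open>y k t'\<close>, \<open>t' < t\<close>, were
  rejected; entries of the sequences that are not reached are meaningless.
\<close>

definition accepted where
  "accepted f blk \<alpha> x ik y k t \<longleftrightarrow> sufficient_descent f blk \<alpha> (x k) (ik k) (y k t)"

definition reached where
  "reached f blk \<alpha> x ik y k t \<longleftrightarrow>
     (\<forall>k'<k. \<exists>t'. accepted f blk \<alpha> x ik y k' t') \<and>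
     (\<forall>t'<t. \<not> accepted f blk \<alpha> x ik y k t')"

definition increases where
  "increases f blk \<alpha> x ik y k = (LEAST t. accepted f blk \<alpha> x ik y k t)"

locale bcd_run = bcd_problem f nblocks blk \<Omega> nops A ng g
  for f :: "real ^ 'n::finite \<Rightarrow> real"
    and nblocks :: nat
    and blk :: "'n \<Rightarrow> nat"
    and \<Omega> :: "nat \<Rightarrow> (real ^ 'n) set"
    and nops :: "nat \<Rightarrow> nat"
    and A :: "nat \<Rightarrow> nat \<Rightarrow> (real ^ 'n) set"
    and ng :: "nat \<Rightarrow> nat \<Rightarrow> nat"
    and g :: "nat \<Rightarrow> nat \<Rightarrow> nat \<Rightarrow> real ^ 'n \<Rightarrow> real" +
  fixes \<alpha> \<delta> \<theta> \<sigma>min :: real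
    and x :: "nat \<Rightarrow> real ^ 'n"
    and ik :: "nat \<Rightarrow> nat"
    and B :: "nat \<Rightarrow> real ^ 'n ^ 'n"
    and j :: "nat \<Rightarrow> nat \<Rightarrow> nat"
    and y :: "nat \<Rightarrow> nat \<Rightarrow> real ^ 'n"
    and \<mu> :: "nat \<Rightarrow> nat \<Rightarrow> nat \<Rightarrow> real"
  assumes parameters: "\<alpha> > 0" "\<delta> \<ge> 0" "\<theta> > 0" "\<sigma>min > 0"
    and start: "i \<in> {1..nblocks} \<Longrightarrow> block blk i (x 0) \<in> \<Omega> i"
    and block_chosen: "ik k \<in> {1..nblocks}"
    and matrix_chosen: "block_symmetric blk (ik k) (B k)"
    and step2_possible: "reached f blk \<alpha> x ik y k t \<Longrightarrow>
        step2 f blk nops A ng g \<delta> \<theta> (x k) (ik k) (B k) (sigma_seq \<sigma>min t) (j k t) (y k t) (\<mu> k t)"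
    and step3_accept: "\<lbrakk>reached f blk \<alpha> x ik y k t; accepted f blk \<alpha> x ik y k t\<rbrakk>
        \<Longrightarrow> x (Suc k) = replace_block blk (ik k) (y k t) (x k)"

definition lipschitz_assumption where
  "lipschitz_assumption f nblocks blk \<alpha> x ik y \<gamma> \<longleftrightarrow>
     (\<forall>k t. reached f blk \<alpha> x ik y k t \<longrightarrow>
        norm (partial_grad blk f (ik k) (x k)
              - partial_grad blk f (ik k) (replace_block blk (ik k) (y k t) (x k)))
          \<le> \<gamma> * norm (block blk (ik k) (x k) - y k t) \<and>
        f (replace_block blk (ik k) (y k t) (x k))
          \<le> f (x k) + partial_grad blk f (ik k) (x k) \<bullet> (y k t - block blk (ik k) (x k))
             + \<gamma> / 2 * (norm (block blk (ik k) (x k) - y k t))\<^sup>2) \<and>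
     (\<forall>k1 k2. \<forall>d\<in>{1..nblocks}.
        (\<forall>i\<in>{1..nblocks}. i \<noteq> d \<longrightarrow> block blk i (x k1) = block blk i (x k2)) \<longrightarrow>
        (\<forall>i\<in>{1..nblocks}. norm (partial_grad blk f i (x k1) - partial_grad blk f i (x k2))
           \<le> \<gamma> * norm (block blk d (x k2) - block blk d (x k1))))"

text \<open>Iterations are numbered from 0, while \<open>enumerate S 0\<close> is the smallest element of \<open>S\<close>.\<close>

definition block_choice_assumption :: "nat \<Rightarrow> (nat \<Rightarrow> nat) \<Rightarrow> nat \<Rightarrow> bool" where
  "block_choice_assumption nblocks ik m \<longleftrightarrow>
     m \<ge> 1 \<and>
     (\<forall>\<nu>\<in>{1..nblocks}. infinite {k. ik k = \<nu>} \<and>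
        enumerate {k. ik k = \<nu>} 0 \<le> m \<and>
        (\<forall>q. enumerate {k. ik k = \<nu>} (Suc q) - enumerate {k. ik k = \<nu>} q \<le> m))"

definition latest :: "(nat \<Rightarrow> nat) \<Rightarrow> nat \<Rightarrow> nat \<Rightarrow> nat" where
  "latest ik i k = Max {k'. k' \<le> k \<and> ik k' = i}"

text \<open>
  \<open>x (k + 1)\<close> is approximately stationary with tolerances \<open>\<delta>\<close> and \<open>\<epsilon>\<close>; \<open>op\<close> and \<open>mult\<close> are
  the index \<open>o(i,k)\<close> and the multipliers of the trial point accepted when block \<open>i\<close> was last
  updated.
\<close>

definition approx_stationary where
  "approx_stationary f nblocks blk A ng g \<alpha> \<delta> x ik j y \<mu> \<epsilon> k \<longleftrightarrow>
     (\<forall>i\<in>{1..nblocks}.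
        let kh = latest ik i k;
            th = increases f blk \<alpha> x ik y kh;
            op = j kh th;
            mult = \<mu> kh th;
            z = block blk i (x (k + 1))
        in z \<in> A i op \<and>
           (\<forall>l\<in>{1..ng i op}. mult l \<ge> 0 \<and> min (mult l) (- g i op l z) \<le> \<delta>) \<and>
           norm (partial_grad blk f i (x (k + 1))
                 + (\<Sum>l\<in>{1..ng i op}. mult l *\<^sub>R block_grad blk i (g i op l) z)) \<le> \<epsilon>)"

end

theory Submission
  imports Defs
begin

text \<open>
  The argument has three parts.

  \<^emph>\<open>Ending of the inner loop.\<close> With \<open>\<sigma> > 0\<close> the trial point satisfies the model decrease of
  Alternative 1, so the quadratic upper bound for \<open>f\<close> turns the model into
  \<open>f(trial) \<le> f(x) - (\<sigma> - \<gamma> - c\<^sub>B) / 2 * \<parallel>s\<parallel>\<^sup>2\<close>, and the descent test succeeds as soon as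
  \<open>\<sigma> \<ge> \<gamma> + c\<^sub>B + 2 \<alpha>\<close>. Doubling reaches this threshold after logarithmically many increases
  and ends with \<open>\<sigma>\<close> at most \<open>\<sigma>max\<close>, twice the threshold (lemmas \<open>increases_bound\<close> and
  \<open>accepted_sigma_le\<close>).

  \<^emph>\<open>Stationarity is controlled by the last \<open>m\<close> steps.\<close> When block \<open>i\<close> was last updated, at
  iteration \<open>kh\<close>, its stationarity residual was at most \<open>c\<^sub>4\<close> times the length of that step; each
  later step changes the gradient with respect to block \<open>i\<close> by at most \<open>\<gamma>\<close> times its length and
  leaves the block itself alone. The choice of blocks guarantees that \<open>kh\<close> is among the last \<open>m\<close>
  iterations. So an iterate that is not approximately stationary has steps with total length
  greater than \<open>\<epsilon> / c\<^sub>4\<close> in a window of \<open>m\<close> iterations (lemma \<open>short_window_stationary\<close>).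

  \<^emph>\<open>Counting.\<close> By the Cauchy-Schwarz inequality, such a window has a sum of squared steps greater
  than \<open>(\<epsilon> / c\<^sub>4)\<^sup>2 / m\<close>. Every iteration lies in at most \<open>m\<close> windows, and the squared steps
  have total at most \<open>(f (x 0) - f_bound) / \<alpha>\<close> because of the descent test. Double counting hence
  bounds the number of such iterates by \<open>(f (x 0) - f_bound) / (\<alpha> (\<epsilon> / (c\<^sub>4 m))\<^sup>2)\<close> (lemma
  \<open>card_nonstationary_le\<close>), which is at most \<open>N\<close> since there is at least one block. Squares matter
  here: counting windows that contain a step longer than \<open>\<epsilon> / (c\<^sub>4 m)\<close> would give \<open>m\<close> times this
  number, and \<open>m\<close> can exceed \<open>nblocks\<close>.
\<close>

section \<open>Block arithmetic\<close>

lemma block_replace_block_same: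
  assumes "y \<in> block_space blk i"
  shows "block blk i (replace_block blk i y x) = y"
  using assms by (auto simp: block_def replace_block_def block_space_def vec_eq_iff)

lemma block_replace_block_other:
  "i \<noteq> d \<Longrightarrow> block blk i (replace_block blk d y x) = block blk i x"
  by (auto simp: block_def replace_block_def vec_eq_iff)

lemma replace_block_diff:
  assumes "y \<in> block_space blk i"
  shows "replace_block blk i y x - x = y - block blk i x"
  using assms by (auto simp: block_def replace_block_def block_space_def vec_eq_iff)

section \<open>Sliding windows\<close>

text \<open>
  Double counting: an index \<open>l\<close> lies in the windows \<open>{l. l \<le> k \<and> k < l + m}\<close> of the \<open>m\<close> indices
  \<open>k = l, ..., l + m - 1\<close> only.
\<close>

lemma sum_windows_le:
  fixes a :: "nat \<Rightarrow> real"
  assumes nonneg: "\<And>l. a l \<ge> 0" and K: "K \<subseteq> {..<n}"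
  shows "(\<Sum>k\<in>K. \<Sum>l | l \<le> k \<and> k < l + m. a l) \<le> real m * (\<Sum>l<n. a l)"
proof -
  have finK: "finite K" using K finite_subset by blast
  have "(\<Sum>k\<in>K. \<Sum>l | l \<le> k \<and> k < l + m. a l)
      = (\<Sum>k\<in>K. \<Sum>l | l \<in> {..<n} \<and> (l \<le> k \<and> k < l + m). a l)"
    using K by (intro sum.cong refl) auto
  also have "\<dots> = (\<Sum>l<n. \<Sum>k | k \<in> K \<and> (l \<le> k \<and> k < l + m). a l)"
    using finK by (intro sum.swap_restrict) auto
  also have "\<dots> = (\<Sum>l<n. real (card {k \<in> K. l \<le> k \<and> k < l + m}) * a l)"
    by simp
  also have "\<dots> \<le> (\<Sum>l<n. real m * a l)"
  proof (intro sum_mono mult_right_mono nonneg)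
    fix l
    have "card {k \<in> K. l \<le> k \<and> k < l + m} \<le> card {l..<l + m}"
      by (intro card_mono) auto
    then show "real (card {k \<in> K. l \<le> k \<and> k < l + m}) \<le> real m"
      by simp
  qed
  finally show ?thesis
    by (simp add: sum_distrib_left)
qed

lemma card_window_le: "card {l. l \<le> k \<and> k < l + m} \<le> m" for k m :: nat
proof -
  have "card {l. l \<le> k \<and> k < l + m} \<le> card {Suc k - m..<Suc k}"
    by (intro card_mono) auto
  then show ?thesis by simp
qed

lemma finite_window: "finite {l. l \<le> k \<and> k < l + m}" for k m :: nat
  by (rule finite_subset[of _ "{..k}"]) auto

text \<open>
  The Cauchy-Schwarz inequality in a window converts a large sum into a large sum of squares, and
  double counting then limits the number of windows with a large sum.
\<close>

lemma card_large_windows_le: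
  fixes d :: "nat \<Rightarrow> real"
  assumes sq: "\<And>n. (\<Sum>l<n. (d l)\<^sup>2) \<le> D"
    and r: "r > 0" and K: "finite K"
    and large: "\<And>k. k \<in> K \<Longrightarrow> r \<le> (\<Sum>l | l \<le> k \<and> k < l + m. d l)"
  shows "real (card K) * r\<^sup>2 \<le> (real m)\<^sup>2 * D"
proof -
  obtain n where n: "K \<subseteq> {..<n}"
    using K finite_nat_set_iff_bounded by auto
  have "r\<^sup>2 \<le> real m * (\<Sum>l | l \<le> k \<and> k < l + m. (d l)\<^sup>2)" if "k \<in> K" for k
  proof -
    let ?W = "{l. l \<le> k \<and> k < l + m}"
    have "r\<^sup>2 \<le> (\<Sum>l\<in>?W. d l)\<^sup>2"
      using large[OF that] r by (intro power_mono) auto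
    also have "\<dots> \<le> (\<Sum>l\<in>?W. (d l)\<^sup>2) * (\<Sum>l\<in>?W. 1\<^sup>2)"
      using Cauchy_Schwarz_ineq_sum[of d "\<lambda>_. 1" ?W] by simp
    also have "\<dots> \<le> (\<Sum>l\<in>?W. (d l)\<^sup>2) * real m"
      using card_window_le[of k m] by (intro mult_left_mono sum_nonneg) auto
    finally show ?thesis by (simp add: mult.commute)
  qed
  then have "(\<Sum>k\<in>K. r\<^sup>2) \<le> (\<Sum>k\<in>K. real m * (\<Sum>l | l \<le> k \<and> k < l + m. (d l)\<^sup>2))"
    by (intro sum_mono)
  also have "\<dots> = real m * (\<Sum>k\<in>K. \<Sum>l | l \<le> k \<and> k < l + m. (d l)\<^sup>2)"
    by (simp add: sum_distrib_left)
  also have "\<dots> \<le> real m * (real m * (\<Sum>l<n. (d l)\<^sup>2))"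
    using n by (intro mult_left_mono sum_windows_le) auto
  also have "\<dots> \<le> real m * (real m * D)"
    using sq by (intro mult_left_mono) auto
  finally show ?thesis by (simp add: power2_eq_square mult.assoc)
qed

lemma finite_if_finite_subsets_card_le:
  assumes "\<And>K. K \<subseteq> S \<Longrightarrow> finite K \<Longrightarrow> real (card K) \<le> b"
  shows "finite S"
proof (rule ccontr)
  assume "infinite S"
  then obtain K where "finite K" "card K = Suc (nat \<lfloor>b\<rfloor>)" "K \<subseteq> S"
    using infinite_arbitrarily_large by metis
  with assms[of K] show False by linarith
qed

section \<open>The latest update of a block\<close>

lemma latest_update:
  assumes choice: "block_choice_assumption nblocks ik m"
    and i: "i \<in> {1..nblocks}" and k: "m \<le> k"
  shows "ik (latest ik i k) = i" and "latest ik i k \<le> k" and "k < latest ik i k + m"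
    and "\<And>l. latest ik i k < l \<Longrightarrow> l \<le> k \<Longrightarrow> ik l \<noteq> i"
proof -
  let ?S = "{k. ik k = i}" and ?P = "{k'. k' \<le> k \<and> ik k' = i}"
  have inf: "infinite ?S" and first: "enumerate ?S 0 \<le> m"
    and gap: "\<And>q. enumerate ?S (Suc q) - enumerate ?S q \<le> m"
    using choice i by (auto simp: block_choice_assumption_def)
  have fin: "finite ?P" by (rule finite_subset[of _ "{..k}"]) auto
  have "enumerate ?S 0 \<in> ?P"
    using first k enumerate_in_set[OF inf, of 0] by auto
  then have L: "latest ik i k \<in> ?P"
    unfolding latest_def by (intro Max_in fin) auto
  then show 1: "ik (latest ik i k) = i" and "latest ik i k \<le> k" by auto
  show after: "ik l \<noteq> i" if "latest ik i k < l" "l \<le> k" for l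
  proof
    assume "ik l = i"
    then have "l \<le> latest ik i k"
      unfolding latest_def using that by (intro Max_ge fin) auto
    then show False using that by simp
  qed
  obtain q where q: "enumerate ?S q = latest ik i k"
    using enumerate_Ex[of ?S] inf 1 by (metis mem_Collect_eq)
  have lt: "latest ik i k < enumerate ?S (Suc q)"
    using enumerate_step[OF inf, of q] q by simp
  have "ik (enumerate ?S (Suc q)) = i"
    using enumerate_in_set[OF inf, of "Suc q"] by simp
  then have "k < enumerate ?S (Suc q)"
    using after[OF lt] by linarith
  then show "k < latest ik i k + m"
    using gap[of q] q lt by linarith
qed

section \<open>The inner loop\<close>

lemma sigma_seq_Suc:
  assumes "\<sigma>min > 0"
  shows "sigma_seq \<sigma>min (Suc t) = \<sigma>min * 2 ^ t"
proof (induction t)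
  case 0
  then show ?case using assms by simp
next
  case (Suc t)
  have "\<sigma>min * 1 \<le> \<sigma>min * 2 ^ Suc t"
    using assms by (intro mult_left_mono) (auto simp: one_le_power simp del: power_Suc)
  then show ?case
    using Suc by (subst sigma_seq.simps(2)) (simp del: sigma_seq.simps)
qed

lemma sigma_seq_nonneg: "\<sigma>min > 0 \<Longrightarrow> sigma_seq \<sigma>min t \<ge> 0"
  by (cases t) (auto simp: sigma_seq_Suc simp del: sigma_seq.simps(2))

locale bcd_bounded_run = bcd_run f nblocks blk \<Omega> nops A ng g \<alpha> \<delta> \<theta> \<sigma>min x ik B j y \<mu>
  for f :: "real ^ 'n::finite \<Rightarrow> real"
    and nblocks blk \<Omega> nops A ng g \<alpha> \<delta> \<theta> \<sigma>min x ik B j y \<mu> +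
  fixes \<gamma> c\<^sub>B :: real
  assumes gamma_pos: "\<gamma> > 0"
    and lipschitz: "lipschitz_assumption f nblocks blk \<alpha> x ik y \<gamma>"
    and cB_pos: "c\<^sub>B > 0"
    and hessian_bound: "onorm ((*v) (B k)) \<le> c\<^sub>B"
    and sigma_min_less: "\<sigma>min < 2 * (\<gamma> + c\<^sub>B + 2 * \<alpha>)"
begin

abbreviation "last_trial \<equiv> increases f blk \<alpha> x ik y"

lemma threshold_pos: "\<gamma> + c\<^sub>B + 2 * \<alpha> > 0"
  using gamma_pos cB_pos parameters by simp

lemma norm_B_le: "norm (B k *v s) \<le> c\<^sub>B * norm s"
proof -
  have "norm (B k *v s) \<le> onorm ((*v) (B k)) * norm s"
    by (rule onorm[OF matrix_vector_mul_bounded_linear])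
  also have "\<dots> \<le> c\<^sub>B * norm s"
    by (intro mult_right_mono hessian_bound) simp
  finally show ?thesis .
qed

lemma reached_trial_in_block:
  assumes "reached f blk \<alpha> x ik y k t"
  shows "y k t \<in> block_space blk (ik k)"
  using step2_possible[OF assms] A_open[OF block_chosen, of "j k t" k]
  by (auto simp: step2_def dest: openin_imp_subset)

lemma accepted_if_sigma_large:
  assumes reached: "reached f blk \<alpha> x ik y k t"
    and large: "\<gamma> + c\<^sub>B + 2 * \<alpha> \<le> sigma_seq \<sigma>min t"
  shows "accepted f blk \<alpha> x ik y k t"
proof -
  define s where "s = y k t - block blk (ik k) (x k)"
  have "sigma_seq \<sigma>min t \<noteq> 0"
    using large threshold_pos by linarith
  then have model: "partial_grad blk f (ik k) (x k) \<bullet> s + 1 / 2 * (s \<bullet> (B k *v s))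
      + sigma_seq \<sigma>min t / 2 * (norm s)\<^sup>2 \<le> 0"
    using step2_possible[OF reached]
    by (auto simp: step2_def alternative1_def Let_def s_def)
  have upper: "f (replace_block blk (ik k) (y k t) (x k))
      \<le> f (x k) + partial_grad blk f (ik k) (x k) \<bullet> s + \<gamma> / 2 * (norm s)\<^sup>2"
    using lipschitz reached
    by (auto simp: lipschitz_assumption_def s_def norm_minus_commute)
  have "\<bar>s \<bullet> (B k *v s)\<bar> \<le> norm s * norm (B k *v s)"
    by (rule Cauchy_Schwarz_ineq2)
  also have "\<dots> \<le> norm s * (c\<^sub>B * norm s)"
    by (intro mult_left_mono norm_B_le) simp
  finally have curvature: "- (c\<^sub>B * (norm s)\<^sup>2) \<le> s \<bullet> (B k *v s)"
    by (simp add: power2_eq_square algebra_simps abs_le_iff)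
  have "(\<gamma> + c\<^sub>B + 2 * \<alpha>) * (norm s)\<^sup>2 \<le> sigma_seq \<sigma>min t * (norm s)\<^sup>2"
    using large by (intro mult_right_mono) auto
  then have "f (replace_block blk (ik k) (y k t) (x k)) \<le> f (x k) - \<alpha> * (norm s)\<^sup>2"
    using model upper curvature by (simp add: algebra_simps)
  then show ?thesis
    by (simp add: accepted_def sufficient_descent_def s_def)
qed

text \<open>
  One increase brings \<open>\<sigma>\<close> from 0 to \<open>\<sigma>min\<close>, and the doublings do the rest. Since \<open>\<sigma>min\<close> is below
  twice the threshold, the logarithm exceeds -1, so that rounding it up to a natural number is
  harmless.
\<close>

lemma accepted_within_bound:
  assumes previous: "\<forall>k'<k. \<exists>t. accepted f blk \<alpha> x ik y k' t"
  shows "\<exists>t \<le> Suc (nat \<lceil>log 2 ((\<gamma> + c\<^sub>B + 2 * \<alpha>) / \<sigma>min)\<rceil>). accepted f blk \<alpha> x ik y k t"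
proof (rule ccontr)
  define L where "L = \<gamma> + c\<^sub>B + 2 * \<alpha>"
  define n where "n = nat \<lceil>log 2 (L / \<sigma>min)\<rceil>"
  assume "\<not> ?thesis"
  then have rejected: "\<forall>t\<le>Suc n. \<not> accepted f blk \<alpha> x ik y k t"
    by (auto simp: n_def L_def)
  then have reached: "reached f blk \<alpha> x ik y k (Suc n)"
    using previous by (auto simp: reached_def)
  have pos: "L / \<sigma>min > 0"
    using threshold_pos parameters by (simp add: L_def)
  have "L / \<sigma>min = 2 powr log 2 (L / \<sigma>min)"
    using pos by simp
  also have "\<dots> \<le> 2 powr real n"
    by (intro powr_mono) (auto simp: n_def real_nat_ceiling_ge)
  finally have "L \<le> sigma_seq \<sigma>min (Suc n)"
    using parameters by (simp add: sigma_seq_Suc powr_realpow field_simps del: sigma_seq.simps)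
  then show False
    using accepted_if_sigma_large[OF reached] rejected by (auto simp: L_def)
qed

lemma ex_accepted: "\<exists>t. accepted f blk \<alpha> x ik y k t"
  by (induction k rule: less_induct) (metis accepted_within_bound)

lemma accepted_last_trial: "accepted f blk \<alpha> x ik y k (last_trial k)"
  unfolding increases_def by (rule LeastI_ex[OF ex_accepted])

lemma reached_iff: "reached f blk \<alpha> x ik y k t \<longleftrightarrow> t \<le> last_trial k"
  unfolding reached_def increases_def
  by (metis ex_accepted LeastI Least_le not_less_Least leI le_less_trans)

lemma reached_last_trial: "reached f blk \<alpha> x ik y k (last_trial k)"
  by (simp add: reached_iff)

lemma increases_bound:
  "int (last_trial k + 1) \<le> \<lceil>log 2 ((\<gamma> + c\<^sub>B + 2 * \<alpha>) / \<sigma>min) + 2\<rceil>"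
proof -
  define L where "L = \<gamma> + c\<^sub>B + 2 * \<alpha>"
  have "\<exists>t \<le> Suc (nat \<lceil>log 2 (L / \<sigma>min)\<rceil>). accepted f blk \<alpha> x ik y k t"
    unfolding L_def by (rule accepted_within_bound) (simp add: ex_accepted)
  then have "last_trial k \<le> Suc (nat \<lceil>log 2 (L / \<sigma>min)\<rceil>)"
    unfolding increases_def by (meson Least_le order_trans)
  moreover have "log 2 (L / \<sigma>min) > -1"
  proof -
    have "2 powr (-1) < L / \<sigma>min"
      using sigma_min_less parameters by (simp add: L_def powr_minus field_simps)
    then show ?thesis
      using parameters threshold_pos by (subst less_log_iff) (auto simp: L_def)
  qed
  then have "0 \<le> \<lceil>log 2 (L / \<sigma>min)\<rceil>" by linarith
  ultimately show ?thesis
    unfolding L_def[symmetric] by linarith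
qed

text \<open>
  Either \<open>\<sigma>\<close> is 0 or \<open>\<sigma>min\<close>, or its half was rejected and is therefore below the acceptance
  threshold.
\<close>

lemma accepted_sigma_le: "sigma_seq \<sigma>min (last_trial k) \<le> 2 * (\<gamma> + c\<^sub>B + 2 * \<alpha>)"
proof (cases "last_trial k")
  case 0
  then show ?thesis using threshold_pos by simp
next
  case (Suc t)
  have "sigma_seq \<sigma>min t < \<gamma> + c\<^sub>B + 2 * \<alpha>"
  proof (rule ccontr)
    assume "\<not> ?thesis"
    then have "accepted f blk \<alpha> x ik y k t"
      using Suc by (intro accepted_if_sigma_large) (auto simp: reached_iff)
    then have "last_trial k \<le> t"
      unfolding increases_def by (rule Least_le)
    then show False using Suc by simp
  qed
  then show ?thesis using Suc sigma_min_less by simp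
qed

section \<open>Steps between iterates\<close>

abbreviation "step k \<equiv> norm (x (Suc k) - x k)"

lemma next_iterate: "x (Suc k) = replace_block blk (ik k) (y k (last_trial k)) (x k)"
  by (rule step3_accept[OF reached_last_trial accepted_last_trial])

lemma last_trial_in_block: "y k (last_trial k) \<in> block_space blk (ik k)"
  by (rule reached_trial_in_block[OF reached_last_trial])

lemma trial_minus_block: "y k (last_trial k) - block blk (ik k) (x k) = x (Suc k) - x k"
  using replace_block_diff[OF last_trial_in_block] by (simp add: next_iterate)

lemma updated_block: "block blk (ik k) (x (Suc k)) = y k (last_trial k)"
  using block_replace_block_same[OF last_trial_in_block] by (simp add: next_iterate)

lemma other_block: "ik k \<noteq> i \<Longrightarrow> block blk i (x (Suc k)) = block blk i (x k)"
  using block_replace_block_other[of i "ik k"] by (simp add: next_iterate)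

lemma step_descent: "\<alpha> * (step k)\<^sup>2 \<le> f (x k) - f (x (Suc k))"
  using accepted_last_trial[of k]
  by (simp add: accepted_def sufficient_descent_def trial_minus_block flip: next_iterate)

lemma sum_squared_steps_le:
  assumes "\<forall>k. f_bound \<le> f (x k)"
  shows "(\<Sum>l<n. (step l)\<^sup>2) \<le> (f (x 0) - f_bound) / \<alpha>"
proof -
  have "\<alpha> * (\<Sum>l<n. (step l)\<^sup>2) \<le> (\<Sum>l<n. f (x l) - f (x (Suc l)))"
    unfolding sum_distrib_left by (intro sum_mono step_descent)
  also have "\<dots> = f (x 0) - f (x n)"
    by (rule sum_lessThan_telescope')
  also have "\<dots> \<le> f (x 0) - f_bound"
    using assms by simp
  finally show ?thesis
    using parameters by (simp add: field_simps)
qed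

lemma partial_grad_step:
  assumes "i \<in> {1..nblocks}"
  shows "norm (partial_grad blk f i (x (Suc k)) - partial_grad blk f i (x k)) \<le> \<gamma> * step k"
proof -
  have "\<forall>i\<in>{1..nblocks}. i \<noteq> ik k \<longrightarrow> block blk i (x (Suc k)) = block blk i (x k)"
    using other_block by metis
  then have "norm (partial_grad blk f i (x (Suc k)) - partial_grad blk f i (x k))
      \<le> \<gamma> * norm (block blk (ik k) (x k) - block blk (ik k) (x (Suc k)))"
    using lipschitz assms block_chosen[of k] unfolding lipschitz_assumption_def by blast
  then show ?thesis
    by (metis updated_block trial_minus_block norm_minus_commute)
qed

lemma partial_grad_steps:
  assumes "i \<in> {1..nblocks}"
  shows "norm (partial_grad blk f i (x (p + n)) - partial_grad blk f i (x p))
    \<le> \<gamma> * (\<Sum>l\<in>{p..<p + n}. step l)"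
proof (induction n)
  case (Suc n)
  have "norm (partial_grad blk f i (x (p + Suc n)) - partial_grad blk f i (x p))
      \<le> norm (partial_grad blk f i (x (Suc (p + n))) - partial_grad blk f i (x (p + n)))
        + norm (partial_grad blk f i (x (p + n)) - partial_grad blk f i (x p))"
    using norm_triangle_ineq[of "partial_grad blk f i (x (Suc (p + n))) - partial_grad blk f i (x (p + n))"
      "partial_grad blk f i (x (p + n)) - partial_grad blk f i (x p)"] by simp
  also have "\<dots> \<le> \<gamma> * step (p + n) + \<gamma> * (\<Sum>l\<in>{p..<p + n}. step l)"
    by (intro add_mono partial_grad_step assms Suc.IH)
  finally show ?case by (simp add: algebra_simps)
qed simp

lemma block_unchanged:
  assumes "\<And>l. p \<le> l \<Longrightarrow> l < p + n \<Longrightarrow> ik l \<noteq> i"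
  shows "block blk i (x (p + n)) = block blk i (x p)"
  using assms by (induction n) (auto simp: other_block)

section \<open>Approximate stationarity\<close>

lemma norm_add_diff_diff_le: "norm (a + b - c - d) \<le> norm a + norm b + norm c + norm d"
  for a b c d :: "real ^ 'a::finite"
  by norm

lemma norm_triangle_shift: "norm (b + c) \<le> norm (a + c) + norm (b - a)"
  for a b c :: "real ^ 'a::finite"
  by norm

abbreviation (input) "multiplier_sum i o' w z \<equiv>
  \<Sum>l\<in>{1..ng i o'}. w l *\<^sub>R block_grad blk i (g i o' l) z"

text \<open>
  Under Alternative 1, the terms \<open>B s\<close> and \<open>\<sigma> s\<close>, the model tolerance \<open>\<theta> \<parallel>s\<parallel>\<close> and the passage of
  the gradient to the new iterate contribute the four summands of the constant. Under Alternative 2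
  the residual vanishes at the new iterate.
\<close>

lemma residual_after_update:
  fixes k :: nat
  defines "t \<equiv> last_trial k"
  shows "norm (partial_grad blk f (ik k) (x (Suc k)) + multiplier_sum (ik k) (j k t) (\<mu> k t) (y k t))
    \<le> (c\<^sub>B + 2 * (\<gamma> + c\<^sub>B + 2 * \<alpha>) + \<theta> + \<gamma>) * step k"
proof -
  let ?M = "multiplier_sum (ik k) (j k t) (\<mu> k t) (y k t)"
  let ?s = "x (Suc k) - x k" and ?\<sigma> = "sigma_seq \<sigma>min t"
  let ?g0 = "partial_grad blk f (ik k) (x k)" and ?g1 = "partial_grad blk f (ik k) (x (Suc k))"
  have "step2 f blk nops A ng g \<delta> \<theta> (x k) (ik k) (B k) ?\<sigma> (j k t) (y k t) (\<mu> k t)"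
    unfolding t_def by (intro step2_possible reached_last_trial)
  then consider "norm (?g0 + B k *v ?s + ?\<sigma> *\<^sub>R ?s + ?M) \<le> \<theta> * step k" | "norm (?g1 + ?M) = 0"
    by (auto simp: step2_def alternative1_def alternative2_def Let_def t_def trial_minus_block
        simp flip: next_iterate)
  then show ?thesis
  proof cases
    case 1
    have sigma: "norm (?\<sigma> *\<^sub>R ?s) \<le> 2 * (\<gamma> + c\<^sub>B + 2 * \<alpha>) * step k"
      using accepted_sigma_le[of k] sigma_seq_nonneg[of \<sigma>min t] parameters
      by (auto simp: t_def intro!: mult_right_mono)
    have split: "?g1 + ?M = (?g0 + B k *v ?s + ?\<sigma> *\<^sub>R ?s + ?M) + (?g1 - ?g0) - B k *v ?s - ?\<sigma> *\<^sub>R ?s"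
      by simp
    have "norm (?g1 + ?M) \<le> norm (?g0 + B k *v ?s + ?\<sigma> *\<^sub>R ?s + ?M) + norm (?g1 - ?g0)
        + norm (B k *v ?s) + norm (?\<sigma> *\<^sub>R ?s)"
      unfolding split by (rule norm_add_diff_diff_le)
    also have "\<dots> \<le> \<theta> * step k + \<gamma> * step k + c\<^sub>B * step k
        + 2 * (\<gamma> + c\<^sub>B + 2 * \<alpha>) * step k"
      by (rule add_mono[OF add_mono[OF add_mono[OF 1 partial_grad_step[OF block_chosen]]
          norm_B_le] sigma])
    also have "\<dots> = (c\<^sub>B + 2 * (\<gamma> + c\<^sub>B + 2 * \<alpha>) + \<theta> + \<gamma>) * step k"
      by (simp only: distrib_right add_ac)
    finally show ?thesis .
  next
    case 2
    then show ?thesis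
      using gamma_pos cB_pos parameters by simp
  qed
qed

text \<open>
  Block \<open>i\<close> has kept its value since its latest update, so only the gradient of \<open>f\<close> has drifted.
  The constant dominates \<open>\<gamma>\<close>, so it covers the drift as well.
\<close>

lemma short_window_stationary:
  assumes choice: "block_choice_assumption nblocks ik m" and k: "m \<le> k"
    and c: "c = c\<^sub>B + 2 * (\<gamma> + c\<^sub>B + 2 * \<alpha>) + \<theta> + \<gamma>"
    and short: "c * (\<Sum>l | l \<le> k \<and> k < l + m. step l) \<le> \<epsilon>"
  shows "approx_stationary f nblocks blk A ng g \<alpha> \<delta> x ik j y \<mu> \<epsilon> k"
proof -
  have "block blk i (x (k + 1)) \<in> A i (j kh t) \<and>
      (\<forall>l\<in>{1..ng i (j kh t)}. \<mu> kh t l \<ge> 0 \<and>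
        min (\<mu> kh t l) (- g i (j kh t) l (block blk i (x (k + 1)))) \<le> \<delta>) \<and>
      norm (partial_grad blk f i (x (k + 1))
        + multiplier_sum i (j kh t) (\<mu> kh t) (block blk i (x (k + 1)))) \<le> \<epsilon>"
    if i: "i \<in> {1..nblocks}" and kh: "kh = latest ik i k" and t: "t = last_trial kh" for i kh t
  proof -
    note L = latest_update[OF choice i k, folded kh]
    define n where "n = k - kh"
    have k1: "k + 1 = Suc kh + n"
      using L(2) by (simp add: n_def)
    have z: "block blk i (x (k + 1)) = y kh t"
    proof -
      have "block blk i (x (Suc kh + n)) = block blk i (x (Suc kh))"
        using L(4) k1 by (intro block_unchanged) auto
      then show ?thesis
        using updated_block[of kh] L(1) t k1 by simp
    qed
    have step2: "step2 f blk nops A ng g \<delta> \<theta> (x kh) i (B kh) (sigma_seq \<sigma>min t) (j kh t) (y kh t) (\<mu> kh t)"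
      using step2_possible[OF reached_last_trial, of kh] L(1) t by simp
    have compl: "\<mu> kh t l \<ge> 0 \<and> min (\<mu> kh t l) (- g i (j kh t) l (y kh t)) \<le> \<delta>"
      if "l \<in> {1..ng i (j kh t)}" for l
      using step2 that parameters(2) order_trans[of _ 0 \<delta>]
      unfolding step2_def alternative1_def alternative2_def Let_def by blast
    have cpos: "0 \<le> c" and cge: "\<gamma> \<le> c"
      using gamma_pos cB_pos parameters by (auto simp: c)
    let ?M = "multiplier_sum i (j kh t) (\<mu> kh t) (y kh t)"
    have "norm (partial_grad blk f i (x (k + 1)) + ?M)
        \<le> norm (partial_grad blk f i (x (Suc kh)) + ?M)
          + norm (partial_grad blk f i (x (k + 1)) - partial_grad blk f i (x (Suc kh)))"
      by (rule norm_triangle_shift)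
    also have "\<dots> \<le> c * step kh + \<gamma> * (\<Sum>l\<in>{Suc kh..<Suc kh + n}. step l)"
      unfolding k1
      using residual_after_update[of kh] L(1) t
      by (intro add_mono partial_grad_steps i) (simp add: c)
    also have "\<dots> \<le> c * step kh + c * (\<Sum>l\<in>{Suc kh..<Suc kh + n}. step l)"
      using cge by (intro add_mono mult_right_mono sum_nonneg) auto
    also have "\<dots> = c * (\<Sum>l\<in>{kh..<Suc kh + n}. step l)"
      by (subst sum.atLeast_Suc_lessThan[of kh "Suc kh + n"]) (simp, simp only: distrib_left)
    also have "\<dots> \<le> c * (\<Sum>l | l \<le> k \<and> k < l + m. step l)"
      using cpos k1 L(3) by (intro mult_left_mono sum_mono2 finite_window) auto
    finally have "norm (partial_grad blk f i (x (k + 1)) + ?M) \<le> \<epsilon>"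
      using short by simp
    then show ?thesis
      using step2 compl unfolding z by (auto simp: step2_def)
  qed
  then show ?thesis
    unfolding approx_stationary_def Let_def by blast
qed

lemma card_nonstationary_le:
  assumes choice: "block_choice_assumption nblocks ik m"
    and c: "c = c\<^sub>B + 2 * (\<gamma> + c\<^sub>B + 2 * \<alpha>) + \<theta> + \<gamma>"
    and low: "\<forall>k. f_bound \<le> f (x k)" and eps: "\<epsilon> > 0"
    and K: "finite K" "K \<subseteq> {k. k \<ge> m \<and> \<not> approx_stationary f nblocks blk A ng g \<alpha> \<delta> x ik j y \<mu> \<epsilon> k}"
  shows "real (card K) \<le> (f (x 0) - f_bound) / (\<alpha> * (\<epsilon> / (c * real m))\<^sup>2)"
proof -
  have cpos: "c > 0"
    using gamma_pos cB_pos parameters by (simp add: c)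
  have mpos: "real m > 0"
    using choice by (simp add: block_choice_assumption_def)
  have "\<epsilon> / c \<le> (\<Sum>l | l \<le> k \<and> k < l + m. step l)" if "k \<in> K" for k
    using short_window_stationary[OF choice _ c, of k \<epsilon>] K(2) that cpos
    by (force simp: field_simps)
  then have "real (card K) * (\<epsilon> / c)\<^sup>2 \<le> (real m)\<^sup>2 * ((f (x 0) - f_bound) / \<alpha>)"
    using eps cpos by (intro card_large_windows_le[OF sum_squared_steps_le[OF low] _ K(1)]) auto
  then show ?thesis
    using eps cpos mpos parameters(1) by (simp add: field_simps power2_eq_square)
qed

end

section \<open>Complexity of the block coordinate descent method\<close>

theorem theorem4p2:
  fixes f :: "real ^ 'n::finite \<Rightarrow> real"
    and \<gamma> c\<^sub>B \<sigma>max c\<^sub>4 f_bound \<epsilon> :: real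
    and m :: nat
  assumes run: "bcd_run f nblocks blk \<Omega> nops A ng g \<alpha> \<delta> \<theta> \<sigma>min x ik B j y \<mu>"
    and lipschitz: "\<gamma> > 0" "lipschitz_assumption f nblocks blk \<alpha> x ik y \<gamma>"
    and bounded_hessian: "c\<^sub>B > 0" "\<forall>k. onorm ((*v) (B k)) \<le> c\<^sub>B"
    and lower_bounded: "bdd_below (range (\<lambda>k. f (x k)))"
    and block_choice: "block_choice_assumption nblocks ik m"
    and \<sigma>max: "\<sigma>max = 2 * (\<gamma> + c\<^sub>B + 2 * \<alpha>)"
    and \<sigma>min_less_\<sigma>max: "\<sigma>min < \<sigma>max"
    and c\<^sub>4: "c\<^sub>4 = c\<^sub>B + \<sigma>max + \<theta> + \<gamma>"
    and f_bound: "\<forall>k. f_bound \<le> f (x k)"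
    and \<epsilon>: "\<epsilon> > 0"
  defines "N \<equiv> real nblocks * ((f (x 0) - f_bound) / (\<alpha> * (\<epsilon> / (c\<^sub>4 * real m))\<^sup>2))"
    and "good \<equiv> approx_stationary f nblocks blk A ng g \<alpha> \<delta> x ik j y \<mu> \<epsilon>"
  shows "(\<exists>k\<ge>m. good k \<and> real k \<le> real m + N) \<and>
         finite {k. k \<ge> m \<and> \<not> good k} \<and> real (card {k. k \<ge> m \<and> \<not> good k}) \<le> N \<and>
         (\<forall>k. \<exists>t. reached f blk \<alpha> x ik y k t \<and> accepted f blk \<alpha> x ik y k t \<and>
                  int (t + 1) \<le> \<lceil>log 2 ((\<gamma> + c\<^sub>B + 2 * \<alpha>) / \<sigma>min) + 2\<rceil>)"
proof -
  interpret bcd_bounded_run f nblocks blk \<Omega> nops A ng g \<alpha> \<delta> \<theta> \<sigma>min x ik B j y \<mu> \<gamma> c\<^sub>B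
    using run lipschitz bounded_hessian \<sigma>min_less_\<sigma>max \<sigma>max
    by (simp add: bcd_bounded_run_def bcd_bounded_run_axioms_def)
  define N\<^sub>1 where "N\<^sub>1 = (f (x 0) - f_bound) / (\<alpha> * (\<epsilon> / (c\<^sub>4 * real m))\<^sup>2)"
  let ?bad = "{k. k \<ge> m \<and> \<not> good k}"
  have "N\<^sub>1 \<ge> 0"
    using f_bound parameters(1) by (simp add: N\<^sub>1_def)
  moreover have "nblocks \<ge> 1"
    using block_chosen[of 0] by simp
  ultimately have "N\<^sub>1 \<le> N"
    using mult_right_mono[of 1 "real nblocks" N\<^sub>1] by (simp add: N_def N\<^sub>1_def)
  then have bad_le: "real (card K) \<le> N" if "K \<subseteq> ?bad" "finite K" for K
    using card_nonstationary_le[OF block_choice _ f_bound \<epsilon> that(2), of c\<^sub>4] that(1) c\<^sub>4 \<sigma>max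
    by (simp add: good_def N\<^sub>1_def)
  then have fin: "finite ?bad"
    by (rule finite_if_finite_subsets_card_le)
  have N_nonneg: "N \<ge> 0"
    using bad_le[of "{}"] by simp
  \<comment> \<open>The \<open>\<lfloor>N\<rfloor> + 1\<close> indices from \<open>m\<close> on are more than \<open>N\<close>, so one of them is good.\<close>
  have "\<exists>k\<ge>m. good k \<and> real k \<le> real m + N"
  proof (rule ccontr)
    assume none: "\<not> ?thesis"
    have "k \<in> ?bad" if "k \<in> {m..m + nat \<lfloor>N\<rfloor>}" for k
    proof -
      have "real k \<le> real m + N"
        using that N_nonneg by (auto simp: le_nat_floor) linarith
      then show ?thesis using none that by auto
    qed
    then have "{m..m + nat \<lfloor>N\<rfloor>} \<subseteq> ?bad" by blast
    from bad_le[OF this] show False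
      by simp linarith
  qed
  moreover have "\<exists>t. reached f blk \<alpha> x ik y k t \<and> accepted f blk \<alpha> x ik y k t \<and>
      int (t + 1) \<le> \<lceil>log 2 ((\<gamma> + c\<^sub>B + 2 * \<alpha>) / \<sigma>min) + 2\<rceil>" for k
    using reached_last_trial accepted_last_trial increases_bound by blast
  ultimately show ?thesis
    using fin bad_le[OF subset_refl fin] by blast
qed

end
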